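(* Suppose that $X$ is a Tychonoff topological space. Then $\mathrm{Rad}(\Gamma(C(X))) = \mathrm{Rad}(\mathbb{AG}(C(X)))$, and this common value is $2$ if $X$ has an isolated point and $3$ if $X$ does not have any isolated point.
   Context: $C(X)$ is the ring of all real-valued continuous functions on $X$. For a commutative ring $R$ and $S\subseteq R$, $\mathrm{Ann}(S)=\{x\in R: Sx=\{0\}\}$. $Z(R)^*$ is the set of non-zero $a\in R$ with $\mathrm{Ann}(a)\neq\{0\}$; the zero-divisor graph $\Gamma(R)$ has vertex set $Z(R)^*$, distinct $a,b$ being adjacent iff $ab=0$. $\mathbb{A}(R)^*$ is the set of non-zero ideals $I$ of $R$ with $\mathrm{Ann}(I)\neq\{0\}$; the annihilating-ideal graph $\mathbb{AG}(R)$ has vertex set $\mathbb{A}(R)^*$, distinct $I,J$ being adjacent iff $IJ=\{0\}$. For a graph $G$, $d(u,v)$ is the length of a shortest path between $u$ and $v$, $\mathrm{ecc}(u)=\max\{d(u,v): v\in V(G)\}$, and $\mathrm{Rad}(G)=\min\{\mathrm{ecc}(u): u\in V(G)\}$.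
   Formalization: The formal statement assumes that X has at least three points; with two points Rad(Γ(C(X))) = 2 but Rad(AG(C(X))) = 1, and with at most one point both graphs have no vertices, so the radius is undefined. *)

theory Defs
  imports
    "HOL-Analysis.Analysis"
    "HOL-Algebra.Ideal_Product"
    "HOL-Library.Extended_Nat"
    "Graph_Theory.Pair_Digraph"
begin

definition Tychonoff_space :: "'a topology \<Rightarrow> bool" where
  "Tychonoff_space X \<longleftrightarrow> completely_regular_space X \<and> Hausdorff_space X"

definition isolated_point :: "'a topology \<Rightarrow> 'a \<Rightarrow> bool" where
  "isolated_point X p \<longleftrightarrow> p \<in> topspace X \<and> openin X {p}"


(* HOL functions are total on the type 'a; requiring them to be extensional outside the
   space identifies functions that agree on the space. *)
definition cont_ring :: "'a topology \<Rightarrow> ('a \<Rightarrow> real) ring" where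
  "cont_ring X =
     \<lparr> carrier = {f \<in> extensional (topspace X). continuous_map X euclideanreal f},
       monoid.mult = (\<lambda>f g. \<lambda>x\<in>topspace X. f x * g x),
       one = (\<lambda>x\<in>topspace X. 1),
       zero = (\<lambda>x\<in>topspace X. 0),
       add = (\<lambda>f g. \<lambda>x\<in>topspace X. f x + g x) \<rparr>"

lemma cring_cont_ring: "cring (cont_ring X)"
proof -
  have restr: "continuous_map X euclideanreal (restrict f (topspace X)) \<longleftrightarrow>
      continuous_map X euclideanreal f" for f
    by (rule iffI; erule continuous_map_eq) auto
  show ?thesis
  proof (rule cringI)
    show "abelian_group (cont_ring X)"
    proof (rule abelian_groupI)
      fix f assume f: "f \<in> carrier (cont_ring X)"
      show "\<exists>g\<in>carrier (cont_ring X). g \<oplus>\<^bsub>cont_ring X\<^esub> f = \<zero>\<^bsub>cont_ring X\<^esub>"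
        using f
        by (intro bexI[of _ "\<lambda>x\<in>topspace X. - f x"])
           (auto simp: cont_ring_def restr continuous_map_minus fun_eq_iff)
    qed (auto simp: cont_ring_def restr continuous_map_add fun_eq_iff extensional_def)
    show "comm_monoid (cont_ring X)"
      by (rule comm_monoidI)
         (auto simp: cont_ring_def restr continuous_map_real_mult fun_eq_iff extensional_def)
  qed (auto simp: cont_ring_def fun_eq_iff algebra_simps)
qed


definition Ann :: "('a, 'm) ring_scheme \<Rightarrow> 'a set \<Rightarrow> 'a set" where
  "Ann R S = {x \<in> carrier R. \<forall>s\<in>S. s \<otimes>\<^bsub>R\<^esub> x = \<zero>\<^bsub>R\<^esub>}"

definition zero_divisors :: "('a, 'm) ring_scheme \<Rightarrow> 'a set" where
  "zero_divisors R = {a \<in> carrier R. a \<noteq> \<zero>\<^bsub>R\<^esub> \<and> Ann R {a} \<noteq> {\<zero>\<^bsub>R\<^esub>}}"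

definition annihilating_ideals :: "('a, 'm) ring_scheme \<Rightarrow> 'a set set" where
  "annihilating_ideals R = {I. ideal I R \<and> I \<noteq> {\<zero>\<^bsub>R\<^esub>} \<and> Ann R I \<noteq> {\<zero>\<^bsub>R\<^esub>}}"


(* Undirected graphs are represented as digraphs with a symmetric arc relation. *)
definition zero_divisor_graph :: "('a, 'm) ring_scheme \<Rightarrow> 'a pair_pre_digraph" where
  "zero_divisor_graph R =
     \<lparr> pverts = zero_divisors R,
       parcs = {(a, b). a \<in> zero_divisors R \<and> b \<in> zero_divisors R \<and> a \<noteq> b \<and>
                        a \<otimes>\<^bsub>R\<^esub> b = \<zero>\<^bsub>R\<^esub>} \<rparr>"

definition annihilating_ideal_graph :: "('a, 'm) ring_scheme \<Rightarrow> 'a set pair_pre_digraph" where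
  "annihilating_ideal_graph R =
     \<lparr> pverts = annihilating_ideals R,
       parcs = {(I, J). I \<in> annihilating_ideals R \<and> J \<in> annihilating_ideals R \<and> I \<noteq> J \<and>
                        ideal_prod R I J = {\<zero>\<^bsub>R\<^esub>}} \<rparr>"


(* The values are extended naturals: the distance is infinity if there is no path, the
   eccentricity is infinity if the distances are unbounded, and the radius of the graph
   without vertices is infinity.  A nonempty infimum in enat is attained, and so is a
   finite nonempty supremum, so these are the usual minima and maxima. *)
definition graph_dist :: "'v pair_pre_digraph \<Rightarrow> 'v \<Rightarrow> 'v \<Rightarrow> enat" where
  "graph_dist G u v = (INF p\<in>{p. pre_digraph.apath (with_proj G) u p v}. enat (length p))"

definition graph_ecc :: "'v pair_pre_digraph \<Rightarrow> 'v \<Rightarrow> enat" where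
  "graph_ecc G u = (SUP v\<in>pverts G. graph_dist G u v)"

definition graph_radius :: "'v pair_pre_digraph \<Rightarrow> enat" where
  "graph_radius G = (INF u\<in>pverts G. graph_ecc G u)"

end

theory Submission
  imports Defs
begin

text \<open>
  Both graphs are zero-divisor graphs of reduced commutative monoids with zero: the
  multiplicative monoid of \<open>C(X)\<close>, and the monoid of its ideals.  In such a monoid any two
  vertices \<open>u\<close>, \<open>v\<close> are at distance at most \<open>3\<close>: if \<open>a\<close> annihilates \<open>u\<close> and \<open>b\<close> annihilates \<open>v\<close>,
  then \<open>u - ab - v\<close> or \<open>u - a - b - v\<close> is a walk.

  If \<open>p\<close> is isolated, the annihilator of the characteristic function of \<open>p\<close> is prime, which
  gives a vertex of eccentricity at most \<open>2\<close>; no vertex has eccentricity at most \<open>1\<close>, because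
  three points of \<open>X\<close> provide enough bump functions.  If there is no isolated point and
  \<open>f \<noteq> 0\<close>, pick two points \<open>p\<close>, \<open>p'\<close> of the cozero set of \<open>f\<close>, and a function \<open>v\<close> that vanishes
  near \<open>p\<close> and equals \<open>1\<close> at \<open>p'\<close> and off the cozero set of \<open>f\<close>.  Then \<open>f v \<noteq> 0\<close>, and nothing but
  \<open>0\<close> annihilates both \<open>f\<close> and \<open>v\<close>, so that the distance from \<open>f\<close> to \<open>v\<close> is \<open>3\<close>.
\<close>

section \<open>Distances of at most three\<close>

text \<open>\<open>pcas\<close> and \<open>pawalk_verts\<close> are recursive on lists of pairs, so
  simplification can evaluate paths that are given as explicit lists of arcs.\<close>

lemma apath_with_proj_iff:
  "pre_digraph.apath (with_proj G) u p v \<longleftrightarrow>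
     u \<in> pverts G \<and> set p \<subseteq> parcs G \<and> pcas u p v \<and> distinct (pawalk_verts u p)"
  by (auto simp: pre_digraph.apath_def pre_digraph.awalk_def cas_with_proj_eq
      awalk_verts_with_proj_eq)

lemma graph_dist_le:
  assumes "pre_digraph.apath (with_proj G) u p v"
  shows "graph_dist G u v \<le> enat (length p)"
  using assms unfolding graph_dist_def by (auto intro: INF_lower)

context pair_loopfree_digraph
begin

lemma graph_dist_self:
  assumes "u \<in> pverts G"
  shows "graph_dist G u u = 0"
  using graph_dist_le[of G u "[]" u] assms by (simp add: apath_with_proj_iff flip: zero_enat_def)

lemma graph_dist_arc:
  assumes "(u, v) \<in> parcs G"
  shows "graph_dist G u v \<le> 1"
  using graph_dist_le[of G u "[(u, v)]" v] assms in_arcsD1[OF assms] no_loops'[OF assms]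
  by (simp add: apath_with_proj_iff one_enat_def)

lemma graph_dist_walk2:
  assumes "(u, a) \<in> parcs G" "(a, v) \<in> parcs G"
  shows "graph_dist G u v \<le> 2"
\<comment> \<open>The walk may return to its start and then is not a path; the distance is 0 in that
  case.\<close>
proof (cases "u = v")
  case True
  then show ?thesis using graph_dist_self in_arcsD1[OF assms(1)] by simp
next
  case False
  then show ?thesis
    using graph_dist_le[of G u "[(u, a), (a, v)]" v] assms in_arcsD1[OF assms(1)]
      no_loops'[OF assms(1)] no_loops'[OF assms(2)]
    by (simp add: apath_with_proj_iff numeral_eq_enat numeral_2_eq_2)
qed

text \<open>Without loops consecutive vertices differ, so a walk of three arcs fails to be a path
  only if \<open>u = v\<close>, \<open>u = b\<close> or \<open>a = v\<close>. In each of these cases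
  at most one arc is needed.\<close>

lemma graph_dist_walk3:
  assumes "(u, a) \<in> parcs G" "(a, b) \<in> parcs G" "(b, v) \<in> parcs G"
  shows "graph_dist G u v \<le> 3"
proof -
  have le: "(0::enat) \<le> 3" "(1::enat) \<le> 3"
    by (simp_all add: one_enat_def numeral_eq_enat)
  consider "u = v" | "u = b" | "a = v" | "u \<noteq> v" "u \<noteq> b" "a \<noteq> v" by blast
  then show ?thesis
  proof cases
    case 1
    then show ?thesis using graph_dist_self in_arcsD1[OF assms(1)] by simp
  next
    case 2
    then show ?thesis using graph_dist_arc[OF assms(3)] le order_trans by blast
  next
    case 3
    then show ?thesis using graph_dist_arc[OF assms(1)] le order_trans by blast
  next
    case 4
    then show ?thesis
      using graph_dist_le[of G u "[(u, a), (a, b), (b, v)]" v] assms in_arcsD1[OF assms(1)]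
        no_loops'[OF assms(1)] no_loops'[OF assms(2)] no_loops'[OF assms(3)]
      by (simp add: apath_with_proj_iff numeral_eq_enat numeral_3_eq_3)
  qed
qed

end

text \<open>A shorter list of arcs is empty, which forces \<open>u = v\<close>, or is the single arc
  \<open>(u, v)\<close>. If there is no path, the infimum is infinity and the bound holds as
  well.\<close>

lemma graph_dist_ge2:
  assumes "u \<noteq> v" "(u, v) \<notin> parcs G"
  shows "2 \<le> graph_dist G u v"
  unfolding graph_dist_def
proof (rule INF_greatest)
  fix p assume "p \<in> {p. pre_digraph.apath (with_proj G) u p v}"
  then have p: "set p \<subseteq> parcs G" "pcas u p v"
    by (auto simp: apath_with_proj_iff)
  have "\<not> length p < 2"
  proof
    assume "length p < 2"
    then consider "p = []" | e where "p = [e]"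
      by (cases p; cases "tl p") auto
    then show False using p assms by cases auto
  qed
  then show "2 \<le> enat (length p)" by (simp add: numeral_eq_enat)
qed

text \<open>A path of two arcs would pass through a common neighbour \<open>w\<close>.\<close>

lemma graph_dist_ge3:
  assumes "u \<noteq> v" "(u, v) \<notin> parcs G" "\<And>w. (u, w) \<in> parcs G \<Longrightarrow> (w, v) \<in> parcs G \<Longrightarrow> False"
  shows "3 \<le> graph_dist G u v"
  unfolding graph_dist_def
proof (rule INF_greatest)
  fix p assume "p \<in> {p. pre_digraph.apath (with_proj G) u p v}"
  then have p: "set p \<subseteq> parcs G" "pcas u p v"
    by (auto simp: apath_with_proj_iff)
  have "\<not> length p < 3"
  proof
    assume "length p < 3"
    then consider "p = []" | e where "p = [e]" | e e' where "p = [e, e']"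
      by (cases p; cases "tl p"; cases "tl (tl p)") auto
    then show False using p assms by cases auto
  qed
  then show "3 \<le> enat (length p)" by (simp add: numeral_eq_enat)
qed

section \<open>Bounds for the radius\<close>

lemma graph_radius_le:
  assumes "u \<in> pverts G" "\<And>v. v \<in> pverts G \<Longrightarrow> graph_dist G u v \<le> n"
  shows "graph_radius G \<le> n"
  unfolding graph_radius_def graph_ecc_def using assms by (auto intro!: INF_lower2 SUP_least)

lemma graph_radius_ge:
  assumes "\<And>u. u \<in> pverts G \<Longrightarrow> \<exists>v\<in>pverts G. n \<le> graph_dist G u v"
  shows "n \<le> graph_radius G"
  unfolding graph_radius_def graph_ecc_def
  using assms by (auto intro!: INF_greatest intro: SUP_upper2)


section \<open>Zero-divisor graphs of reduced commutative monoids\<close>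

text \<open>The zero is a parameter, so that one definition serves the elements of a ring, with
  \<open>\<zero>\<close>, and its ideals under \<open>ideal_prod\<close>, with
  \<open>{\<zero>}\<close>.\<close>

definition monoid_zero_divisors :: "('v, 'm) monoid_scheme \<Rightarrow> 'v \<Rightarrow> 'v set" where
  "monoid_zero_divisors M z =
     {a \<in> carrier M. a \<noteq> z \<and> (\<exists>b\<in>carrier M. b \<noteq> z \<and> a \<otimes>\<^bsub>M\<^esub> b = z)}"

definition monoid_graph :: "('v, 'm) monoid_scheme \<Rightarrow> 'v \<Rightarrow> 'v pair_pre_digraph" where
  "monoid_graph M z =
     \<lparr> pverts = monoid_zero_divisors M z,
       parcs = {(a, b). a \<in> monoid_zero_divisors M z \<and> b \<in> monoid_zero_divisors M z \<and>
                        a \<noteq> b \<and> a \<otimes>\<^bsub>M\<^esub> b = z} \<rparr>"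

locale reduced_monoid_zero = comm_monoid M for M (structure) +
  fixes z
  assumes zero_carrier: "z \<in> carrier M"
    and mult_zero: "x \<in> carrier M \<Longrightarrow> x \<otimes> z = z"
    and reduced: "x \<in> carrier M \<Longrightarrow> x \<otimes> x = z \<Longrightarrow> x = z"
begin

abbreviation "V \<equiv> monoid_zero_divisors M z"
abbreviation "G \<equiv> monoid_graph M z"

sublocale pair_loopfree_digraph G
  by unfold_locales (auto simp: monoid_graph_def)

lemma pverts_G [simp]: "pverts G = V"
  by (simp add: monoid_graph_def)

text \<open>\<open>a\<close> and \<open>b\<close> certify each other as zero-divisors, and they
  differ because only \<open>z\<close> has square \<open>z\<close>.\<close>

lemma arcI:
  assumes "a \<in> carrier M" "b \<in> carrier M" "a \<noteq> z" "b \<noteq> z" "a \<otimes> b = z"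
  shows "(a, b) \<in> parcs G"
proof -
  have "b \<otimes> a = z" using assms m_comm by simp
  moreover have "a \<noteq> b" using assms reduced by metis
  ultimately show ?thesis using assms by (auto simp: monoid_graph_def monoid_zero_divisors_def)
qed

lemma VE:
  assumes "u \<in> V"
  obtains a where "u \<in> carrier M" "u \<noteq> z" "a \<in> carrier M" "a \<noteq> z" "u \<otimes> a = z" "a \<otimes> u = z"
  using assms m_comm by (auto simp: monoid_zero_divisors_def)

lemma mult_zero_mult:
  assumes "x \<in> carrier M" "y \<in> carrier M" "w \<in> carrier M" "x \<otimes> y = z"
  shows "x \<otimes> (y \<otimes> w) = z" "x \<otimes> (w \<otimes> y) = z"
proof -
  show "x \<otimes> (y \<otimes> w) = z"
    using assms m_assoc[of x y w] m_comm[of z w] mult_zero zero_carrier by simp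
  then show "x \<otimes> (w \<otimes> y) = z" using assms m_comm by simp
qed

lemma graph_dist_le_3:
  assumes "u \<in> V" "v \<in> V"
  shows "graph_dist G u v \<le> 3"
proof -
  obtain a where a: "u \<in> carrier M" "u \<noteq> z" "a \<in> carrier M" "a \<noteq> z" "u \<otimes> a = z" "a \<otimes> u = z"
    using VE[OF assms(1)] .
  obtain b where b: "v \<in> carrier M" "v \<noteq> z" "b \<in> carrier M" "b \<noteq> z" "v \<otimes> b = z" "b \<otimes> v = z"
    using VE[OF assms(2)] .
  show ?thesis
  proof (cases "a \<otimes> b = z")
    case True
    then show ?thesis using graph_dist_walk3[of u a b v] arcI a b by blast
  next
    case False
    \<comment> \<open>Being a multiple of both \<open>a\<close> and \<open>b\<close>, the product
      annihilates \<open>u\<close> as well as \<open>v\<close>.\<close>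
    have "(u, a \<otimes> b) \<in> parcs G"
      using False a b mult_zero_mult by (intro arcI) auto
    moreover have "v \<otimes> (a \<otimes> b) = z"
      using a b mult_zero_mult by auto
    then have "(a \<otimes> b, v) \<in> parcs G"
      using False a b m_comm[of v "a \<otimes> b"] by (intro arcI) auto
    ultimately have "graph_dist G u v \<le> 2" by (rule graph_dist_walk2)
    moreover have "(2::enat) \<le> 3" by (simp add: numeral_eq_enat)
    ultimately show ?thesis by (rule order_trans)
  qed
qed

text \<open>The hypothesis \<open>prime\<close> says that the annihilator of \<open>e\<close> is
  prime. Applied to \<open>v \<otimes> b = z\<close> it makes \<open>e\<close> adjacent to
  \<open>v\<close>, or makes \<open>e\<close>, \<open>b\<close>, \<open>v\<close> a walk.\<close>

lemma graph_dist_prime_le_2: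
  assumes e: "e \<in> V" and v: "v \<in> V"
    and prime: "\<And>a b. \<lbrakk>a \<in> carrier M; b \<in> carrier M; a \<otimes> b = z\<rbrakk> \<Longrightarrow> e \<otimes> a = z \<or> e \<otimes> b = z"
  shows "graph_dist G e v \<le> 2"
proof -
  obtain b where b: "v \<in> carrier M" "v \<noteq> z" "b \<in> carrier M" "b \<noteq> z" "v \<otimes> b = z" "b \<otimes> v = z"
    using VE[OF v] .
  have ec: "e \<in> carrier M" "e \<noteq> z" using e by (auto simp: monoid_zero_divisors_def)
  from prime[of v b] b consider "e \<otimes> v = z" | "e \<otimes> b = z" by blast
  then show ?thesis
  proof cases
    case 1
    then have "graph_dist G e v \<le> 1" using ec b arcI graph_dist_arc by blast
    moreover have "(1::enat) \<le> 2" by (simp add: numeral_eq_enat one_enat_def)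
    ultimately show ?thesis by (rule order_trans)
  next
    case 2
    then show ?thesis using graph_dist_walk2[of e b v] arcI ec b by blast
  qed
qed

lemma graph_radius_eq_2:
  assumes e: "e \<in> V"
    and prime: "\<And>a b. \<lbrakk>a \<in> carrier M; b \<in> carrier M; a \<otimes> b = z\<rbrakk> \<Longrightarrow> e \<otimes> a = z \<or> e \<otimes> b = z"
    and far: "\<And>u. u \<in> V \<Longrightarrow> \<exists>v\<in>V. u \<noteq> v \<and> u \<otimes> v \<noteq> z"
  shows "graph_radius G = 2"
proof (rule antisym)
  show "graph_radius G \<le> 2"
  proof (rule graph_radius_le)
    show "e \<in> pverts G" using e by simp
    fix v assume "v \<in> pverts G"
    then show "graph_dist G e v \<le> 2"
      using e by (intro graph_dist_prime_le_2) (simp_all add: prime)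
  qed
  show "2 \<le> graph_radius G"
  proof (rule graph_radius_ge)
    fix u assume "u \<in> pverts G"
    then obtain v where v: "v \<in> V" "u \<noteq> v" "u \<otimes> v \<noteq> z" using far by auto
    then have "2 \<le> graph_dist G u v" by (intro graph_dist_ge2) (auto simp: monoid_graph_def)
    then show "\<exists>v\<in>pverts G. 2 \<le> graph_dist G u v" using v by auto
  qed
qed

text \<open>Vertices differ from \<open>z\<close>, so the last clause of \<open>far\<close> excludes
  a common neighbour of \<open>u\<close> and \<open>v\<close>; the first two clauses exclude paths
  of length 0 and 1.\<close>

lemma graph_radius_eq_3:
  assumes ne: "V \<noteq> {}"
    and far: "\<And>u. u \<in> V \<Longrightarrow> \<exists>v\<in>V. u \<noteq> v \<and> u \<otimes> v \<noteq> z \<and>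
                 (\<forall>w\<in>carrier M. u \<otimes> w = z \<longrightarrow> v \<otimes> w = z \<longrightarrow> w = z)"
  shows "graph_radius G = 3"
proof (rule antisym)
  obtain e where "e \<in> V" using ne by blast
  then show "graph_radius G \<le> 3"
    using graph_radius_le[of e G] graph_dist_le_3 by simp
  show "3 \<le> graph_radius G"
  proof (rule graph_radius_ge)
    fix u assume "u \<in> pverts G"
    then obtain v where v: "v \<in> V" "u \<noteq> v" "u \<otimes> v \<noteq> z"
      and w: "\<And>w. \<lbrakk>w \<in> carrier M; u \<otimes> w = z; v \<otimes> w = z\<rbrakk> \<Longrightarrow> w = z" using far by fastforce
    have "3 \<le> graph_dist G u v"
    proof (rule graph_dist_ge3)
      fix w assume "(u, w) \<in> parcs G" "(w, v) \<in> parcs G"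
      then have "w \<in> carrier M" "v \<in> carrier M" "w \<noteq> z" "u \<otimes> w = z" "w \<otimes> v = z"
        by (auto simp: monoid_graph_def monoid_zero_divisors_def)
      then show False using w[of w] m_comm[of w v] by simp
    qed (use v in \<open>auto simp: monoid_graph_def\<close>)
    then show "\<exists>v\<in>pverts G. 3 \<le> graph_dist G u v" using v by auto
  qed
qed

end


section \<open>The two graphs of a reduced commutative ring\<close>

lemma carrier_ideals_set [simp]: "carrier (ideals_set R) = {I. ideal I R}"
  and mult_ideals_set [simp]: "I \<otimes>\<^bsub>ideals_set R\<^esub> J = ideal_prod R I J"
  by (simp_all add: ideals_set_def)

lemma (in ring) ideal_zero_mem: "ideal I R \<Longrightarrow> \<zero> \<in> I"
  by (simp add: additive_subgroup.zero_closed ideal.axioms(1))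

text \<open>The product ideal consists of finite sums of products \<open>i \<otimes> j\<close>, so
  it is zero once these vanish. This reduces adjacency of ideals to products of elements.\<close>

lemma (in ring) ideal_prod_eq_zero_iff:
  assumes "ideal I R" "ideal J R"
  shows "ideal_prod R I J = {\<zero>} \<longleftrightarrow> (\<forall>i\<in>I. \<forall>j\<in>J. i \<otimes> j = \<zero>)"
proof
  assume "ideal_prod R I J = {\<zero>}"
  then show "\<forall>i\<in>I. \<forall>j\<in>J. i \<otimes> j = \<zero>" using ideal_prod.prod[of _ I _ J R] by auto
next
  assume *: "\<forall>i\<in>I. \<forall>j\<in>J. i \<otimes> j = \<zero>"
  have "x = \<zero>" if "x \<in> ideal_prod R I J" for x
    using that by induction (use * in auto)
  then show "ideal_prod R I J = {\<zero>}"
    using ideal_zero_mem[OF ideal_prod_is_ideal[OF assms]] by blast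
qed

lemma (in ring) ideal_neq_zeroE:
  assumes "ideal I R" "I \<noteq> {\<zero>}"
  obtains a where "a \<in> I" "a \<in> carrier R" "a \<noteq> \<zero>"
  using assms ideal_zero_mem[OF assms(1)] ideal.Icarr[OF assms(1)] by blast

context cring
begin

text \<open>\<open>\<zero>\<close> always lies in the annihilator, so differing from
  \<open>{\<zero>}\<close> means having a nonzero element.\<close>

lemma Ann_neq_zero_iff:
  assumes "S \<subseteq> carrier R"
  shows "Ann R S \<noteq> {\<zero>} \<longleftrightarrow> (\<exists>b\<in>carrier R. b \<noteq> \<zero> \<and> (\<forall>s\<in>S. s \<otimes> b = \<zero>))"
proof -
  have "\<zero> \<in> Ann R S" using assms by (auto simp: Ann_def)
  then show ?thesis unfolding Ann_def by blast
qed

lemma cgenideal_neq_zero: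
  assumes "a \<in> carrier R" "a \<noteq> \<zero>"
  shows "PIdl a \<noteq> {\<zero>}"
  using cgenideal_self[OF assms(1)] assms(2) by auto

lemma annihilated_by_cgenideal:
  assumes "a \<in> carrier R" "b \<in> carrier R" "b \<otimes> a = \<zero>"
  shows "\<forall>x\<in>PIdl a. b \<otimes> x = \<zero>"
  using assms by (auto simp: cgenideal_def m_lcomm)

lemma zero_divisors_eq: "zero_divisors R = monoid_zero_divisors R \<zero>"
  unfolding zero_divisors_def monoid_zero_divisors_def using Ann_neq_zero_iff[of "{_}"] by auto

text \<open>A nonzero \<open>b\<close> that annihilates \<open>I\<close> generates a nonzero ideal
  that annihilates \<open>I\<close>; conversely, every nonzero element of such an ideal lies in
  \<open>Ann R I\<close>.\<close>

lemma annihilating_ideals_eq: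
  "annihilating_ideals R = monoid_zero_divisors (ideals_set R) {\<zero>}"
proof -
  have "Ann R I \<noteq> {\<zero>} \<longleftrightarrow> (\<exists>J. ideal J R \<and> J \<noteq> {\<zero>} \<and> ideal_prod R I J = {\<zero>})"
    (is "?L \<longleftrightarrow> ?R") if I: "ideal I R" for I
  proof -
    have sub: "I \<subseteq> carrier R" using ideal.Icarr[OF I] by blast
    show ?thesis
    proof
      assume ?L
      then obtain b where b: "b \<in> carrier R" "b \<noteq> \<zero>" "\<forall>s\<in>I. s \<otimes> b = \<zero>"
        using Ann_neq_zero_iff[OF sub] by blast
      then have "ideal_prod R I (PIdl b) = {\<zero>}"
        using annihilated_by_cgenideal[OF b(1)] sub
        by (subst ideal_prod_eq_zero_iff[OF I cgenideal_ideal]) auto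
      then show ?R
        using cgenideal_ideal cgenideal_neq_zero b by blast
    next
      assume ?R
      then obtain J where J: "ideal J R" "J \<noteq> {\<zero>}" "ideal_prod R I J = {\<zero>}" by blast
      obtain b where b: "b \<in> J" "b \<in> carrier R" "b \<noteq> \<zero>" using ideal_neq_zeroE[OF J(1,2)] .
      have "\<forall>s\<in>I. s \<otimes> b = \<zero>" using J(3) b(1) ideal_prod_eq_zero_iff[OF I J(1)] by simp
      then have "\<exists>b\<in>carrier R. b \<noteq> \<zero> \<and> (\<forall>s\<in>I. s \<otimes> b = \<zero>)" using b by blast
      then show ?L by (simp only: Ann_neq_zero_iff[OF sub])
    qed
  qed
  then show ?thesis
    unfolding annihilating_ideals_def monoid_zero_divisors_def carrier_ideals_set
      mult_ideals_set by blast
qed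

lemma zero_divisor_graph_eq: "zero_divisor_graph R = monoid_graph R \<zero>"
  by (simp add: zero_divisor_graph_def monoid_graph_def zero_divisors_eq)

lemma annihilating_ideal_graph_eq:
  "annihilating_ideal_graph R = monoid_graph (ideals_set R) {\<zero>}"
  by (simp add: annihilating_ideal_graph_def monoid_graph_def annihilating_ideals_eq)

text \<open>What annihilates \<open>a\<close> annihilates all its multiples. Witnesses found among
  the elements thus carry over to the ideal graph.\<close>

lemma cgenideal_annihilating_ideal:
  assumes "a \<in> zero_divisors R"
  shows "PIdl a \<in> annihilating_ideals R"
proof -
  obtain b where b: "a \<in> carrier R" "a \<noteq> \<zero>" "b \<in> carrier R" "b \<noteq> \<zero>" "a \<otimes> b = \<zero>"
    using assms by (auto simp: zero_divisors_eq monoid_zero_divisors_def)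
  then have "\<forall>x\<in>PIdl a. x \<otimes> b = \<zero>"
    using annihilated_by_cgenideal[of a b] m_comm ideal.Icarr[OF cgenideal_ideal] by metis
  moreover have "PIdl a \<subseteq> carrier R" using ideal.Icarr[OF cgenideal_ideal] b by blast
  ultimately have "Ann R (PIdl a) \<noteq> {\<zero>}" using Ann_neq_zero_iff b by blast
  then show ?thesis
    using b cgenideal_ideal cgenideal_neq_zero by (simp add: annihilating_ideals_def)
qed

end

locale reduced_cring = cring R for R (structure) +
  assumes reduced: "x \<in> carrier R \<Longrightarrow> x \<otimes> x = \<zero> \<Longrightarrow> x = \<zero>"
begin

lemma elements_reduced_monoid: "reduced_monoid_zero R \<zero>"
  by unfold_locales (auto intro: reduced)

text \<open>The square of an ideal contains the squares of its elements, so reducedness passes from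
  the ring to its ideals.\<close>

lemma ideals_reduced_monoid: "reduced_monoid_zero (ideals_set R) {\<zero>}"
proof (intro reduced_monoid_zero.intro reduced_monoid_zero_axioms.intro)
  show "comm_monoid (ideals_set R)" by (rule ideals_set_is_comm_monoid)
  fix I assume "I \<in> carrier (ideals_set R)" "I \<otimes>\<^bsub>ideals_set R\<^esub> I = {\<zero>}"
  then have I: "ideal I R" "\<forall>i\<in>I. i \<otimes> i = \<zero>" by (auto simp: ideal_prod_eq_zero_iff)
  then have "i = \<zero>" if "i \<in> I" for i
    using that reduced ideal.Icarr[OF I(1)] by blast
  then show "I = {\<zero>}" using ideal_zero_mem[OF I(1)] by blast
qed (auto simp: zeroideal ideal_prod_zero)

section \<open>Criteria for radius 2 and 3, for elements and ideals at once\<close>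

text \<open>\<open>far\<close> offers two candidates because a given vertex may coincide with one of
  them. The condition \<open>h \<notin> PIdl g\<close> separates them both as elements and as
  principal ideals.\<close>

theorem radii_eq_2:
  assumes e: "e \<in> zero_divisors R"
    and prime: "\<And>a b. \<lbrakk>a \<in> carrier R; b \<in> carrier R; a \<otimes> b = \<zero>\<rbrakk> \<Longrightarrow> e \<otimes> a = \<zero> \<or> e \<otimes> b = \<zero>"
    and far: "\<And>f. \<lbrakk>f \<in> carrier R; f \<noteq> \<zero>\<rbrakk> \<Longrightarrow> \<exists>g\<in>zero_divisors R. \<exists>h\<in>zero_divisors R.
                f \<otimes> g \<noteq> \<zero> \<and> f \<otimes> h \<noteq> \<zero> \<and> h \<notin> PIdl g"
  shows "graph_radius (zero_divisor_graph R) = 2"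
    and "graph_radius (annihilating_ideal_graph R) = 2"
proof -
  interpret el: reduced_monoid_zero R \<zero> by (rule elements_reduced_monoid)
  interpret id: reduced_monoid_zero "ideals_set R" "{\<zero>}" by (rule ideals_reduced_monoid)
  show "graph_radius (zero_divisor_graph R) = 2"
    unfolding zero_divisor_graph_eq
  proof (rule el.graph_radius_eq_2)
    show "e \<in> monoid_zero_divisors R \<zero>" using e by (simp add: zero_divisors_eq)
  next
    fix u assume "u \<in> monoid_zero_divisors R \<zero>"
    then have "u \<in> carrier R" "u \<noteq> \<zero>" by (auto simp: monoid_zero_divisors_def)
    then obtain g h where gh: "g \<in> zero_divisors R" "h \<in> zero_divisors R"
      "u \<otimes> g \<noteq> \<zero>" "u \<otimes> h \<noteq> \<zero>" "h \<notin> PIdl g" using far by blast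
    \<comment> \<open>Hence \<open>u\<close> differs from at least one of \<open>g\<close> and
      \<open>h\<close>.\<close>
    then have "g \<noteq> h" using cgenideal_self[of g] by (auto simp: zero_divisors_def)
    then show "\<exists>v\<in>monoid_zero_divisors R \<zero>. u \<noteq> v \<and> u \<otimes> v \<noteq> \<zero>"
      using gh by (metis zero_divisors_eq)
  qed (rule prime)
  show "graph_radius (annihilating_ideal_graph R) = 2"
    unfolding annihilating_ideal_graph_eq
  proof (rule id.graph_radius_eq_2)
    have ec: "e \<in> carrier R" using e by (simp add: zero_divisors_def)
    show "PIdl e \<in> monoid_zero_divisors (ideals_set R) {\<zero>}"
      using cgenideal_annihilating_ideal[OF e] by (simp add: annihilating_ideals_eq)
    fix A B assume "A \<in> carrier (ideals_set R)" "B \<in> carrier (ideals_set R)"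
      "A \<otimes>\<^bsub>ideals_set R\<^esub> B = {\<zero>}"
    then have AB: "ideal A R" "ideal B R" "\<And>a b. a \<in> A \<Longrightarrow> b \<in> B \<Longrightarrow> a \<otimes> b = \<zero>"
      by (auto simp: ideal_prod_eq_zero_iff)
    \<comment> \<open>Primeness passes to ideals: one \<open>b\<close> in \<open>B\<close> with
      \<open>e \<otimes> b \<noteq> \<zero>\<close> forces \<open>e\<close> to annihilate every
      element of \<open>A\<close>.\<close>
    have *: "(\<forall>a\<in>A. e \<otimes> a = \<zero>) \<or> (\<forall>b\<in>B. e \<otimes> b = \<zero>)"
    proof (intro disjCI ballI)
      fix a assume a: "a \<in> A" and "\<not> (\<forall>b\<in>B. e \<otimes> b = \<zero>)"
      then obtain b where b: "b \<in> B" "e \<otimes> b \<noteq> \<zero>" by blast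
      show "e \<otimes> a = \<zero>"
        using prime[OF ideal.Icarr[OF AB(1) a] ideal.Icarr[OF AB(2) b(1)] AB(3)[OF a b(1)]] b(2)
        by blast
    qed
    have "ideal_prod R (PIdl e) C = {\<zero>}" if C: "ideal C R" "\<forall>c\<in>C. e \<otimes> c = \<zero>" for C
    proof (subst ideal_prod_eq_zero_iff[OF cgenideal_ideal[OF ec] C(1)], intro ballI)
      fix i c assume ic: "i \<in> PIdl e" "c \<in> C"
      have cc: "c \<in> carrier R" "i \<in> carrier R"
        using ic ideal.Icarr[OF C(1)] ideal.Icarr[OF cgenideal_ideal[OF ec]] by auto
      have "c \<otimes> e = \<zero>" using C(2) ic(2) m_comm[OF ec cc(1)] by simp
      then have "c \<otimes> i = \<zero>" using annihilated_by_cgenideal[OF ec cc(1)] ic(1) by blast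
      then show "i \<otimes> c = \<zero>" using m_comm[OF cc] by simp
    qed
    then show "PIdl e \<otimes>\<^bsub>ideals_set R\<^esub> A = {\<zero>} \<or> PIdl e \<otimes>\<^bsub>ideals_set R\<^esub> B = {\<zero>}"
      using * AB(1,2) unfolding mult_ideals_set by blast
  next
    fix I assume "I \<in> monoid_zero_divisors (ideals_set R) {\<zero>}"
    then have I: "ideal I R" "I \<noteq> {\<zero>}" by (auto simp: monoid_zero_divisors_def)
    obtain f where f: "f \<in> I" "f \<in> carrier R" "f \<noteq> \<zero>" using ideal_neq_zeroE[OF I] .
    then obtain g h where gh: "g \<in> zero_divisors R" "h \<in> zero_divisors R"
      "f \<otimes> g \<noteq> \<zero>" "f \<otimes> h \<noteq> \<zero>" "h \<notin> PIdl g" using far by blast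
    then have "PIdl g \<noteq> PIdl h" using cgenideal_self[of h] by (auto simp: zero_divisors_def)
    moreover have "ideal_prod R I (PIdl k) \<noteq> {\<zero>}"
      if "k \<in> zero_divisors R" "f \<otimes> k \<noteq> \<zero>" for k
    proof -
      have kc: "k \<in> carrier R" using that by (simp add: zero_divisors_def)
      show ?thesis
        using ideal_prod_eq_zero_iff[OF I(1) cgenideal_ideal[OF kc]] cgenideal_self[OF kc] f that
        by blast
    qed
    \<comment> \<open>\<open>I\<close> cannot equal both \<open>PIdl g\<close> and
      \<open>PIdl h\<close>, and its product with either is nonzero.\<close>
    ultimately show "\<exists>J\<in>monoid_zero_divisors (ideals_set R) {\<zero>}.
        I \<noteq> J \<and> I \<otimes>\<^bsub>ideals_set R\<^esub> J \<noteq> {\<zero>}"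
      using gh cgenideal_annihilating_ideal unfolding annihilating_ideals_eq mult_ideals_set
      by metis
  qed
qed

text \<open>The condition \<open>f \<notin> PIdl v\<close> keeps \<open>v\<close> distinct from
  \<open>f\<close>, and \<open>PIdl v\<close> distinct from every ideal that contains
  \<open>f\<close>. An ideal annihilating such an ideal and \<open>PIdl v\<close> consists of
  elements that annihilate both \<open>f\<close> and \<open>v\<close>.\<close>

theorem radii_eq_3:
  assumes ne: "zero_divisors R \<noteq> {}"
    and far: "\<And>f. \<lbrakk>f \<in> carrier R; f \<noteq> \<zero>\<rbrakk> \<Longrightarrow> \<exists>v\<in>zero_divisors R. f \<notin> PIdl v \<and> f \<otimes> v \<noteq> \<zero> \<and>
                (\<forall>w\<in>carrier R. f \<otimes> w = \<zero> \<longrightarrow> v \<otimes> w = \<zero> \<longrightarrow> w = \<zero>)"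
  shows "graph_radius (zero_divisor_graph R) = 3"
    and "graph_radius (annihilating_ideal_graph R) = 3"
proof -
  interpret el: reduced_monoid_zero R \<zero> by (rule elements_reduced_monoid)
  interpret id: reduced_monoid_zero "ideals_set R" "{\<zero>}" by (rule ideals_reduced_monoid)
  show "graph_radius (zero_divisor_graph R) = 3"
    unfolding zero_divisor_graph_eq
  proof (rule el.graph_radius_eq_3)
    show "monoid_zero_divisors R \<zero> \<noteq> {}" using ne by (simp add: zero_divisors_eq)
    fix u assume "u \<in> monoid_zero_divisors R \<zero>"
    then have u: "u \<in> carrier R" "u \<noteq> \<zero>" by (auto simp: monoid_zero_divisors_def)
    obtain v where v: "v \<in> zero_divisors R" "u \<notin> PIdl v" "u \<otimes> v \<noteq> \<zero>"
      "\<forall>w\<in>carrier R. u \<otimes> w = \<zero> \<longrightarrow> v \<otimes> w = \<zero> \<longrightarrow> w = \<zero>"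
      using far[OF u] by (elim bexE conjE)
    then have "u \<noteq> v" using cgenideal_self[of v] by (auto simp: zero_divisors_def)
    then show "\<exists>v\<in>monoid_zero_divisors R \<zero>. u \<noteq> v \<and> u \<otimes> v \<noteq> \<zero> \<and>
        (\<forall>w\<in>carrier R. u \<otimes> w = \<zero> \<longrightarrow> v \<otimes> w = \<zero> \<longrightarrow> w = \<zero>)"
      using v unfolding zero_divisors_eq by (intro bexI[of _ v] conjI)
  qed
  show "graph_radius (annihilating_ideal_graph R) = 3"
    unfolding annihilating_ideal_graph_eq
  proof (rule id.graph_radius_eq_3)
    show "monoid_zero_divisors (ideals_set R) {\<zero>} \<noteq> {}"
      using ne cgenideal_annihilating_ideal annihilating_ideals_eq by auto
    fix I assume "I \<in> monoid_zero_divisors (ideals_set R) {\<zero>}"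
    then have I: "ideal I R" "I \<noteq> {\<zero>}" by (auto simp: monoid_zero_divisors_def)
    obtain f where f: "f \<in> I" "f \<in> carrier R" "f \<noteq> \<zero>" using ideal_neq_zeroE[OF I] .
    obtain v where v: "v \<in> zero_divisors R" "f \<notin> PIdl v" "f \<otimes> v \<noteq> \<zero>"
      and w: "\<forall>w\<in>carrier R. f \<otimes> w = \<zero> \<longrightarrow> v \<otimes> w = \<zero> \<longrightarrow> w = \<zero>"
      using far[OF f(2,3)] by (elim bexE conjE)
    have vc: "v \<in> carrier R" using v by (simp add: zero_divisors_def)
    note J = cgenideal_ideal[OF vc] and self = cgenideal_self[OF vc]
    have "ideal_prod R I (PIdl v) \<noteq> {\<zero>}"
      using ideal_prod_eq_zero_iff[OF I(1) J] self f v by blast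
    moreover have "K = {\<zero>}"
      if K: "ideal K R" "ideal_prod R I K = {\<zero>}" "ideal_prod R (PIdl v) K = {\<zero>}" for K
    proof -
      have "k = \<zero>" if k: "k \<in> K" for k
      proof -
        have "f \<otimes> k = \<zero>" "v \<otimes> k = \<zero>"
          using K(2,3) f(1) self k
          by (simp_all add: ideal_prod_eq_zero_iff[OF I(1) K(1)] ideal_prod_eq_zero_iff[OF J K(1)])
        then show ?thesis using w ideal.Icarr[OF K(1) k] by blast
      qed
      then show ?thesis using ideal_zero_mem[OF K(1)] by blast
    qed
    moreover have "I \<noteq> PIdl v" using f v by blast
    ultimately show "\<exists>J\<in>monoid_zero_divisors (ideals_set R) {\<zero>}.
        I \<noteq> J \<and> I \<otimes>\<^bsub>ideals_set R\<^esub> J \<noteq> {\<zero>} \<and>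
        (\<forall>K\<in>carrier (ideals_set R). I \<otimes>\<^bsub>ideals_set R\<^esub> K = {\<zero>} \<longrightarrow>
           J \<otimes>\<^bsub>ideals_set R\<^esub> K = {\<zero>} \<longrightarrow> K = {\<zero>})"
      using cgenideal_annihilating_ideal[OF v(1)]
      unfolding annihilating_ideals_eq mult_ideals_set carrier_ideals_set by blast
  qed
qed

end


section \<open>Rings of continuous functions\<close>

lemma continuous_map_restrict_iff:
  "continuous_map X Y (restrict f (topspace X)) \<longleftrightarrow> continuous_map X Y f"
  by (rule iffI; erule continuous_map_eq) auto

lemma cont_ring_restrict [simp]:
  "restrict f (topspace X) \<in> carrier (cont_ring X) \<longleftrightarrow> continuous_map X euclideanreal f"
  by (simp add: cont_ring_def continuous_map_restrict_iff)

lemma cont_ring_continuous: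
  "f \<in> carrier (cont_ring X) \<Longrightarrow> continuous_map X euclideanreal f"
  by (simp add: cont_ring_def)

lemma cont_ring_eq_zero_iff:
  assumes "f \<in> carrier (cont_ring X)"
  shows "f = \<zero>\<^bsub>cont_ring X\<^esub> \<longleftrightarrow> (\<forall>x\<in>topspace X. f x = 0)"
  using assms by (auto simp: cont_ring_def fun_eq_iff extensional_def)

lemma cont_ring_mult_eq_zero_iff:
  "f \<otimes>\<^bsub>cont_ring X\<^esub> g = \<zero>\<^bsub>cont_ring X\<^esub> \<longleftrightarrow> (\<forall>x\<in>topspace X. f x = 0 \<or> g x = 0)"
  by (auto simp: cont_ring_def fun_eq_iff)

text \<open>Serves to refute membership in a principal ideal by evaluation at a zero of the
  generator.\<close>

lemma cont_ring_mem_cgenideal: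
  assumes "h \<in> PIdl\<^bsub>cont_ring X\<^esub> g" "x \<in> topspace X" "g x = 0"
  shows "h x = 0"
  using assms by (auto simp: cgenideal_def cont_ring_def)

lemma reduced_cring_cont_ring: "reduced_cring (cont_ring X)"
proof (intro reduced_cring.intro reduced_cring_axioms.intro cring_cont_ring)
  fix f assume "f \<in> carrier (cont_ring X)" "f \<otimes>\<^bsub>cont_ring X\<^esub> f = \<zero>\<^bsub>cont_ring X\<^esub>"
  then show "f = \<zero>\<^bsub>cont_ring X\<^esub>"
    by (simp add: cont_ring_mult_eq_zero_iff cont_ring_eq_zero_iff)
qed

text \<open>\<open>g\<close> is the annihilating function; the points \<open>x\<close> and
  \<open>y\<close> show that \<open>f\<close> and \<open>g\<close> are nonzero in the ring.\<close>

lemma cont_ring_zero_divisorI: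
  assumes "continuous_map X euclideanreal f" "continuous_map X euclideanreal g"
    and "x \<in> topspace X" "f x \<noteq> 0" "y \<in> topspace X" "g y \<noteq> 0"
    and "\<And>t. t \<in> topspace X \<Longrightarrow> f t = 0 \<or> g t = 0"
  shows "restrict f (topspace X) \<in> zero_divisors (cont_ring X)"
proof -
  interpret cring "cont_ring X" by (rule cring_cont_ring)
  have "restrict f (topspace X) \<noteq> \<zero>\<^bsub>cont_ring X\<^esub>" "restrict g (topspace X) \<noteq> \<zero>\<^bsub>cont_ring X\<^esub>"
    using assms by (auto simp: cont_ring_eq_zero_iff)
  moreover have
    "restrict f (topspace X) \<otimes>\<^bsub>cont_ring X\<^esub> restrict g (topspace X) = \<zero>\<^bsub>cont_ring X\<^esub>"
    using assms by (auto simp: cont_ring_mult_eq_zero_iff)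
  ultimately show ?thesis
    using assms unfolding zero_divisors_eq monoid_zero_divisors_def by auto
qed

section \<open>Bump functions and separation of points\<close>

text \<open>Complete regularity provides a function that is 0 at \<open>p\<close> and 1 off
  \<open>U\<close>; subtracting it from 1 gives the bump.\<close>

lemma completely_regular_bump:
  assumes "completely_regular_space X" "openin X U" "p \<in> U"
  obtains f :: "'a \<Rightarrow> real" where "continuous_map X euclideanreal f" "f p = 1"
    "\<forall>x\<in>topspace X - U. f x = 0"
proof -
  have "closedin X (topspace X - U)" "p \<in> topspace X - (topspace X - U)"
    using assms openin_subset by blast+
  then obtain f :: "'a \<Rightarrow> real" where f: "continuous_map X (top_of_set {0..1}) f" "f p = 0"
    "f ` (topspace X - U) \<subseteq> {1}"
    using assms(1) unfolding completely_regular_space_def by blast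
  have "continuous_map X euclideanreal f" using f(1) by (simp add: continuous_map_in_subtopology)
  then have "continuous_map X euclideanreal (\<lambda>x. 1 - f x)" by (intro continuous_intros) auto
  then show thesis using f by (intro that[of "\<lambda>x. 1 - f x"]) auto
qed

text \<open>Each pair of points is separated first; every point then receives the intersection of
  its two neighbourhoods.\<close>

lemma Hausdorff_separate3:
  assumes "Hausdorff_space X" "{p, q, r} \<subseteq> topspace X" "p \<noteq> q" "p \<noteq> r" "q \<noteq> r"
  obtains U V W where "openin X U" "openin X V" "openin X W" "p \<in> U" "q \<in> V" "r \<in> W"
    "U \<inter> V = {}" "U \<inter> W = {}" "V \<inter> W = {}"
proof -
  have sep: "\<exists>U V. openin X U \<and> openin X V \<and> x \<in> U \<and> y \<in> V \<and> U \<inter> V = {}"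
    if "x \<in> topspace X" "y \<in> topspace X" "x \<noteq> y" for x y
    using assms(1) that unfolding Hausdorff_space_def disjnt_def by blast
  obtain A B where AB: "openin X A" "openin X B" "p \<in> A" "q \<in> B" "A \<inter> B = {}"
    using sep[of p q] assms by auto
  obtain C D where CD: "openin X C" "openin X D" "p \<in> C" "r \<in> D" "C \<inter> D = {}"
    using sep[of p r] assms by auto
  obtain E F where EF: "openin X E" "openin X F" "q \<in> E" "r \<in> F" "E \<inter> F = {}"
    using sep[of q r] assms by auto
  show thesis
    by (rule that[of "A \<inter> C" "B \<inter> E" "D \<inter> F"]) (use AB CD EF in auto)
qed

text \<open>A set contained in \<open>{p, a}\<close> has at most two elements. The infinite case is
  listed separately because \<open>card\<close> is 0 on infinite sets.\<close>

lemma exists_two_other_points: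
  assumes "infinite S \<or> card S \<ge> 3"
  obtains q r where "q \<in> S" "r \<in> S" "p \<noteq> q" "p \<noteq> r" "q \<noteq> r"
proof -
  have "\<exists>x\<in>S. x \<notin> {p, a}" for a
  proof (rule ccontr)
    assume "\<not> (\<exists>x\<in>S. x \<notin> {p, a})"
    then have sub: "S \<subseteq> {p, a}" by blast
    then have "finite S" "card S \<le> card {p, a}" by (auto intro: finite_subset card_mono)
    then show False using assms card_insert_le_m1[of 2 "{a}" p] by auto
  qed
  then show thesis using that by (metis insertCI)
qed

section \<open>Witness functions\<close>

text \<open>\<open>g\<close> is a bump at a point \<open>p\<close> where \<open>f\<close> is
  nonzero, and \<open>h\<close> adds to it a bump at \<open>q\<close>. A third point
  \<open>r\<close> carries the bump that annihilates \<open>h\<close>.\<close>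

lemma cont_ring_nonadjacent_pair:
  assumes X: "Tychonoff_space X" and card: "infinite (topspace X) \<or> card (topspace X) \<ge> 3"
    and f: "f \<in> carrier (cont_ring X)" "f \<noteq> \<zero>\<^bsub>cont_ring X\<^esub>"
  shows "\<exists>g\<in>zero_divisors (cont_ring X). \<exists>h\<in>zero_divisors (cont_ring X).
           f \<otimes>\<^bsub>cont_ring X\<^esub> g \<noteq> \<zero>\<^bsub>cont_ring X\<^esub> \<and> f \<otimes>\<^bsub>cont_ring X\<^esub> h \<noteq> \<zero>\<^bsub>cont_ring X\<^esub> \<and>
           h \<notin> PIdl\<^bsub>cont_ring X\<^esub> g"
proof -
  have reg: "completely_regular_space X" and Haus: "Hausdorff_space X"
    using X by (auto simp: Tychonoff_space_def)
  obtain p where p: "p \<in> topspace X" "f p \<noteq> 0"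
    using f by (auto simp: cont_ring_eq_zero_iff)
  obtain q r where qr: "q \<in> topspace X" "r \<in> topspace X" "p \<noteq> q" "p \<noteq> r" "q \<noteq> r"
    using exists_two_other_points[OF card] .
  obtain U V W where UVW: "openin X U" "openin X V" "openin X W" "p \<in> U" "q \<in> V" "r \<in> W"
    "U \<inter> V = {}" "U \<inter> W = {}" "V \<inter> W = {}"
    using Hausdorff_separate3[of X p q r] Haus p qr by auto
  obtain a where a: "continuous_map X euclideanreal a" "a p = 1"
    "\<forall>x\<in>topspace X - U. a x = 0"
    using completely_regular_bump[OF reg UVW(1,4)] .
  obtain b where b: "continuous_map X euclideanreal b" "b q = 1"
    "\<forall>x\<in>topspace X - V. b x = 0"
    using completely_regular_bump[OF reg UVW(2,5)] .
  obtain c where c: "continuous_map X euclideanreal c" "c r = 1"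
    "\<forall>x\<in>topspace X - W. c x = 0"
    using completely_regular_bump[OF reg UVW(3,6)] .
  define g where "g = restrict a (topspace X)"
  define h where "h = restrict (\<lambda>x. a x + b x) (topspace X)"
  have ab: "continuous_map X euclideanreal (\<lambda>x. a x + b x)"
    using a b by (intro continuous_intros)
  have bp: "b p = 0" and aq: "a q = 0" using a(3) b(3) p qr UVW(4,5,7) by blast+
  have ab0: "a t = 0 \<or> b t = 0" if "t \<in> topspace X" for t
    using a(3) b(3) that UVW(7) by blast
  have "g \<in> zero_divisors (cont_ring X)"
    unfolding g_def
    by (rule cont_ring_zero_divisorI[OF a(1) b(1) p(1) _ qr(1)]) (use a(2) b(2) ab0 in auto)
  \<comment> \<open>The bump at \<open>r\<close> annihilates \<open>h\<close>, since
    \<open>W\<close> is disjoint from both \<open>U\<close> and \<open>V\<close>.\<close>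
  moreover have "a t + b t = 0 \<or> c t = 0" if "t \<in> topspace X" for t
  proof (cases "t \<in> W")
    case True
    then have "t \<in> topspace X - U" "t \<in> topspace X - V" using that UVW by blast+
    then show ?thesis using a(3) b(3) by simp
  next
    case False
    then show ?thesis using c(3) that by blast
  qed
  then have "h \<in> zero_divisors (cont_ring X)"
    unfolding h_def
    by (intro cont_ring_zero_divisorI[OF ab c(1) p(1) _ qr(2)]) (use a(2) bp c(2) in auto)
  \<comment> \<open>At \<open>q\<close> the function \<open>g\<close> vanishes while
    \<open>h\<close> equals 1.\<close>
  moreover have "h \<notin> PIdl\<^bsub>cont_ring X\<^esub> g"
    using cont_ring_mem_cgenideal[of h X g q] qr(1) aq b(2) by (auto simp: g_def h_def)
  \<comment> \<open>Both \<open>g\<close> and \<open>h\<close> equal 1 at \<open>p\<close>, where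
    \<open>f\<close> is nonzero.\<close>
  moreover have "f \<otimes>\<^bsub>cont_ring X\<^esub> g \<noteq> \<zero>\<^bsub>cont_ring X\<^esub>" "f \<otimes>\<^bsub>cont_ring X\<^esub> h \<noteq> \<zero>\<^bsub>cont_ring X\<^esub>"
    using p a(2) bp by (auto simp: cont_ring_mult_eq_zero_iff g_def h_def intro!: bexI[of _ p])
  ultimately show ?thesis by blast
qed

text \<open>\<open>{p}\<close> is clopen, so its indicator and one minus it are continuous with
  product zero; the second point \<open>q\<close> makes the latter nonzero.\<close>

lemma cont_ring_isolated_point:
  assumes iso: "isolated_point X p" and Haus: "Hausdorff_space X"
    and q: "q \<in> topspace X" "q \<noteq> p"
  shows "restrict (indicator {p}) (topspace X) \<in> zero_divisors (cont_ring X)"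
proof -
  have p: "p \<in> topspace X" "openin X {p}" using iso by (auto simp: isolated_point_def)
  have "closedin X {p}" using Haus p Hausdorff_imp_t1_space t1_space_closedin_singleton by metis
  then have cl: "openin X (topspace X - {p})" by blast
  have pre: "openin X {x \<in> topspace X. (indicator {p} x :: real) \<in> S}" for S
  proof -
    have "{x \<in> topspace X. (indicator {p} x :: real) \<in> S} =
        (if 1 \<in> S then {p} else {}) \<union> (if 0 \<in> S then topspace X - {p} else {})"
      using p by (auto simp: indicator_def split: if_splits)
    moreover have "openin X (if 1 \<in> S then {p} else {})"
      "openin X (if 0 \<in> S then topspace X - {p} else {})"
      using cl p(2) by simp_all
    ultimately show ?thesis by (simp only: openin_Un)
  qed
  have c: "continuous_map X euclideanreal (indicator {p})"
    using pre by (auto simp: continuous_map_def)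
  have c': "continuous_map X euclideanreal (\<lambda>x. 1 - indicator {p} x)"
    using c by (intro continuous_intros) auto
  show ?thesis
    by (rule cont_ring_zero_divisorI[OF c c' p(1) _ q(1)]) (use q in \<open>auto simp: indicator_def\<close>)
qed

lemma cont_ring_distance_3_witness:
  assumes X: "Tychonoff_space X" and iso: "\<nexists>p. isolated_point X p"
    and f: "f \<in> carrier (cont_ring X)" "f \<noteq> \<zero>\<^bsub>cont_ring X\<^esub>"
  shows "\<exists>v\<in>zero_divisors (cont_ring X).
           f \<notin> PIdl\<^bsub>cont_ring X\<^esub> v \<and> f \<otimes>\<^bsub>cont_ring X\<^esub> v \<noteq> \<zero>\<^bsub>cont_ring X\<^esub> \<and>
           (\<forall>w\<in>carrier (cont_ring X). f \<otimes>\<^bsub>cont_ring X\<^esub> w = \<zero>\<^bsub>cont_ring X\<^esub> \<longrightarrow>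
              v \<otimes>\<^bsub>cont_ring X\<^esub> w = \<zero>\<^bsub>cont_ring X\<^esub> \<longrightarrow> w = \<zero>\<^bsub>cont_ring X\<^esub>)"
proof -
  have reg: "completely_regular_space X" and Haus: "Hausdorff_space X"
    using X by (auto simp: Tychonoff_space_def)
  obtain p where p: "p \<in> topspace X" "f p \<noteq> 0"
    using f by (auto simp: cont_ring_eq_zero_iff)
  define U where "U = {x \<in> topspace X. f x \<in> - {0}}"
  have U: "openin X U"
    unfolding U_def
    by (rule openin_continuous_map_preimage[OF cont_ring_continuous[OF f(1)]])
       (simp add: open_Compl)
  have "p \<in> U" using p by (simp add: U_def)
  \<comment> \<open>The cozero set \<open>U\<close> of \<open>f\<close> is open, so it would make
    \<open>p\<close> isolated if it were a singleton.\<close>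
  moreover have "U \<noteq> {p}" using iso U p by (auto simp: isolated_point_def)
  ultimately obtain p' where p': "p' \<in> U" "p' \<noteq> p" by blast
  then have p'X: "p' \<in> topspace X" by (simp add: U_def)
  have "closedin X {p'}"
    using Haus p'X Hausdorff_imp_t1_space t1_space_closedin_singleton by metis
  \<comment> \<open>Removing \<open>p'\<close> makes the bump vanish at \<open>p'\<close>, so that
    \<open>v\<close> is 1 there although \<open>f\<close> is nonzero.\<close>
  then have Up': "openin X (U - {p'})" using U by (rule openin_diff[rotated])
  have "p \<in> U - {p'}" using \<open>p \<in> U\<close> p' by blast
  obtain a where a: "continuous_map X euclideanreal a" "a p = 1"
    "\<forall>x\<in>topspace X - (U - {p'}). a x = 0"
    using completely_regular_bump[OF reg Up' \<open>p \<in> U - {p'}\<close>] .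
  \<comment> \<open>\<open>v\<close> vanishes where \<open>a\<close> is at least 1/2 and
    \<open>k\<close> where \<open>a\<close> is at most 1/2. Hence \<open>k\<close> annihilates
    \<open>v\<close>; moreover \<open>v\<close> is 0 and \<open>k\<close> is 1 at \<open>p\<close>,
    and \<open>v\<close> is 1 wherever \<open>a\<close> is 0.\<close>
  define v where "v = (\<lambda>x. max 0 (1 - 2 * a x))"
  define k where "k = (\<lambda>x. max 0 (2 * a x - 1))"
  have cv: "continuous_map X euclideanreal v" and ck: "continuous_map X euclideanreal k"
    unfolding v_def k_def using a(1) by (auto intro!: continuous_intros)
  have v1: "v x = 1" if "x \<in> topspace X" "x \<notin> U - {p'}" for x
    using a(3) that by (simp add: v_def)
  have "restrict v (topspace X) \<in> zero_divisors (cont_ring X)"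
    by (rule cont_ring_zero_divisorI[OF cv ck p'X _ p(1)])
       (use v1[OF p'X] a(2) in \<open>auto simp: k_def v_def max_def\<close>)
  moreover have "f \<notin> PIdl\<^bsub>cont_ring X\<^esub> (restrict v (topspace X))"
    using cont_ring_mem_cgenideal[of f X "restrict v (topspace X)" p] p a(2) by (auto simp: v_def)
  moreover have "f \<otimes>\<^bsub>cont_ring X\<^esub> restrict v (topspace X) \<noteq> \<zero>\<^bsub>cont_ring X\<^esub>"
    using p'X p' v1[OF p'X]
    by (auto simp: cont_ring_mult_eq_zero_iff U_def intro!: bexI[of _ p'])
  moreover have "w = \<zero>\<^bsub>cont_ring X\<^esub>"
    if w: "w \<in> carrier (cont_ring X)" "f \<otimes>\<^bsub>cont_ring X\<^esub> w = \<zero>\<^bsub>cont_ring X\<^esub>"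
      "restrict v (topspace X) \<otimes>\<^bsub>cont_ring X\<^esub> w = \<zero>\<^bsub>cont_ring X\<^esub>" for w
  proof -
    \<comment> \<open>On \<open>U\<close> the function \<open>f\<close> is nonzero, and off
      \<open>U\<close> the function \<open>v\<close> is 1, so \<open>w\<close> is forced to vanish
      everywhere.\<close>
    have "w x = 0" if x: "x \<in> topspace X" for x
    proof (cases "x \<in> U")
      case True
      then show ?thesis using w(2) by (auto simp: cont_ring_mult_eq_zero_iff U_def)
    next
      case False
      then show ?thesis using w(3) v1[OF x] x by (force simp: cont_ring_mult_eq_zero_iff)
    qed
    then show ?thesis using w(1) by (simp add: cont_ring_eq_zero_iff)
  qed
  ultimately show ?thesis by blast
qed

theorem corollary3p4:
  fixes X :: "'a topology"
  assumes "Tychonoff_space X"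
    and "infinite (topspace X) \<or> card (topspace X) \<ge> 3"
  shows "graph_radius (zero_divisor_graph (cont_ring X)) =
           graph_radius (annihilating_ideal_graph (cont_ring X)) \<and>
         graph_radius (annihilating_ideal_graph (cont_ring X)) =
           (if \<exists>p. isolated_point X p then 2 else 3)"
proof -
  interpret reduced_cring "cont_ring X" by (rule reduced_cring_cont_ring)
  show ?thesis
  proof (cases "\<exists>p. isolated_point X p")
    case True
    then obtain p where p: "isolated_point X p" ..
    obtain q where q: "q \<in> topspace X" "q \<noteq> p"
      using exists_two_other_points[OF assms(2), of p] by metis
    let ?e = "restrict (indicator {p}) (topspace X) :: 'a \<Rightarrow> real"
    have e: "?e \<in> zero_divisors (cont_ring X)"
      using cont_ring_isolated_point[OF p _ q] assms(1) by (simp add: Tychonoff_space_def)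
    \<comment> \<open>Annihilating \<open>?e\<close> means vanishing at \<open>p\<close>, and a
      product of reals is zero only if a factor is.\<close>
    have prime: "?e \<otimes>\<^bsub>cont_ring X\<^esub> a = \<zero>\<^bsub>cont_ring X\<^esub> \<or> ?e \<otimes>\<^bsub>cont_ring X\<^esub> b = \<zero>\<^bsub>cont_ring X\<^esub>"
      if "a \<otimes>\<^bsub>cont_ring X\<^esub> b = \<zero>\<^bsub>cont_ring X\<^esub>" for a b
      using that p by (auto simp: cont_ring_mult_eq_zero_iff isolated_point_def indicator_def)
    have "graph_radius (zero_divisor_graph (cont_ring X)) = 2"
      "graph_radius (annihilating_ideal_graph (cont_ring X)) = 2"
      by (rule radii_eq_2[OF e], erule prime, rule cont_ring_nonadjacent_pair[OF assms], assumption+)+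
    then show ?thesis using True by simp
  next
    case False
    obtain p where "p \<in> topspace X" using exists_two_other_points[OF assms(2)] by metis
    then have "\<one>\<^bsub>cont_ring X\<^esub> \<noteq> \<zero>\<^bsub>cont_ring X\<^esub>"
      by (auto simp: cont_ring_def fun_eq_iff)
    \<comment> \<open>Applied to the constant function 1, the witness lemma produces a zero-divisor,
      so the graphs have vertices.\<close>
    then have ne: "zero_divisors (cont_ring X) \<noteq> {}"
      using cont_ring_distance_3_witness[OF assms(1) False one_closed] by blast
    have "graph_radius (zero_divisor_graph (cont_ring X)) = 3"
      "graph_radius (annihilating_ideal_graph (cont_ring X)) = 3"
      by (rule radii_eq_3[OF ne], rule cont_ring_distance_3_witness[OF assms(1) False], assumption+)+
    then show ?thesis using False by simp
  qed
qed

end
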